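(* Let $g\in L^\infty([0,1])$ and let $T_g$ be the Toeplitz operator of multiplication by $g$. The following are equivalent: (1) $T_g$ has the uniform Feichtinger property. (2) There is a natural number $K\in\mathbb N$ and an $\epsilon>0$ such that $$\frac1K\sum_{k=0}^{K-1}\Big|g\Big(t-\frac kK\Big)\Big|^2\ge\epsilon\quad\text{a.e.}$$ (3) There are an $\epsilon>0$, a natural number $K$ and $K$ measurable sets $E_k\subset[\frac kK,\frac{k+1}K]$, $0\le k\le K-1$, satisfying: (a) the sets $\{E_k-\frac kK\}_{k=0}^{K-1}$ are disjoint in $[0,\frac1K]$; (b) $\bigcup_{k=0}^{K-1}(E_k-\frac kK)=[0,\frac1K]$; (c) $|g(t)|\ge\epsilon$ on $\bigcup_{k=0}^{K-1}E_k$.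
   Context: $T_g:L^2[0,1]\to L^2[0,1]$, $T_gf=f\cdot g$. Functions on $[0,1]$ are extended $1$-periodically, so that translates $g(t-k/K)$ make sense; as usual for elements of $L^\infty$, pointwise conditions and equalities of sets are understood up to null sets. A family $\{f_i\}_{i\in I}$ in a Hilbert space is a Riesz basic sequence if there are constants $A,B>0$ such that $A\sum|a_i|^2\le\|\sum a_if_i\|^2\le B\sum|a_i|^2$ for all scalars $\{a_i\}$. $T_g$ has the uniform Feichtinger property if there is a $K\in\mathbb N$ such that, with $A_k=\{nK+k\}_{n\in\mathbb Z}$ for $0\le k\le K-1$, the family $\{T_ge^{2\pi int}\}_{n\in A_k}$ is a Riesz basic sequence for all $k=0,1,\dots,K-1$. *)

theory Defs
  imports "HOL-Analysis.Analysis"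
begin

text \<open>
  Elements of \<open>L\<^sup>\<infinity>[0,1]\<close> and \<open>L\<^sup>2[0,1]\<close> are represented by functions \<open>real \<Rightarrow> complex\<close>, of which
  only the values on \<open>[0,1]\<close> matter, and these only up to null sets.
\<close>

abbreviation unit_leb :: "real measure" where
  "unit_leb \<equiv> lebesgue_on {0..1}"

definition Linf_unit :: "(real \<Rightarrow> complex) set" where
  "Linf_unit = {g. g \<in> borel_measurable unit_leb \<and> (\<exists>C. AE t in unit_leb. cmod (g t) \<le> C)}"

definition L2_unit :: "(real \<Rightarrow> complex) set" where
  "L2_unit = {f. f \<in> borel_measurable unit_leb \<and> integrable unit_leb (\<lambda>t. (cmod (f t))\<^sup>2)}"

definition L2_unit_norm :: "(real \<Rightarrow> complex) \<Rightarrow> real" where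
  "L2_unit_norm f = sqrt (\<integral>t. (cmod (f t))\<^sup>2 \<partial>unit_leb)"

text \<open>
  As usual, the scalar families range over the finitely supported ones, so that all sums are finite.
\<close>

definition riesz_basic_sequence :: "('i \<Rightarrow> real \<Rightarrow> complex) \<Rightarrow> 'i set \<Rightarrow> bool" where
  "riesz_basic_sequence f I \<longleftrightarrow>
     (\<forall>i\<in>I. f i \<in> L2_unit) \<and>
     (\<exists>A>0. \<exists>B>0. \<forall>F (a :: 'i \<Rightarrow> complex). finite F \<longrightarrow> F \<subseteq> I \<longrightarrow>
        A * (\<Sum>i\<in>F. (cmod (a i))\<^sup>2) \<le> (L2_unit_norm (\<lambda>t. \<Sum>i\<in>F. a i * f i t))\<^sup>2 \<and>
        (L2_unit_norm (\<lambda>t. \<Sum>i\<in>F. a i * f i t))\<^sup>2 \<le> B * (\<Sum>i\<in>F. (cmod (a i))\<^sup>2))"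

definition toeplitz_op :: "(real \<Rightarrow> complex) \<Rightarrow> (real \<Rightarrow> complex) \<Rightarrow> real \<Rightarrow> complex" where
  "toeplitz_op g f = (\<lambda>t. f t * g t)"

definition char_fun :: "int \<Rightarrow> real \<Rightarrow> complex" where
  "char_fun n = (\<lambda>t. exp (2 * of_real pi * \<i> * of_int n * of_real t))"

definition uniform_feichtinger :: "((real \<Rightarrow> complex) \<Rightarrow> real \<Rightarrow> complex) \<Rightarrow> bool" where
  "uniform_feichtinger T \<longleftrightarrow>
     (\<exists>K::nat. K > 0 \<and>
        (\<forall>k<K. riesz_basic_sequence (\<lambda>n. T (char_fun n)) {n * int K + int k |n. True}))"

text \<open>The 1-periodic extension of the restriction of \<open>g\<close> to \<open>[0,1)\<close>.\<close>

definition periodic_ext :: "(real \<Rightarrow> complex) \<Rightarrow> real \<Rightarrow> complex" where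
  "periodic_ext g t = g (frac t)"

definition ae_disjoint :: "real set \<Rightarrow> real set \<Rightarrow> bool" where
  "ae_disjoint S T \<longleftrightarrow> negligible (S \<inter> T)"

definition ae_equal :: "real set \<Rightarrow> real set \<Rightarrow> bool" where
  "ae_equal S T \<longleftrightarrow> negligible ((S - T) \<union> (T - S))"

end

theory Submission
  imports Defs
begin

text \<open>
  Everything is read off from the function
  \<open>G(t) = (1/K) (\<Sum>k<K. |g(t - k/K)|\<^sup>2)\<close>, called \<open>periodization g K\<close> below, which has
  period \<open>1/K\<close>.  Condition (2) says that \<open>G\<close> is bounded away from zero.

  A trigonometric polynomial \<open>p\<close> with frequencies in one residue class modulo \<open>K\<close> only picks up
  a unimodular constant under translation by \<open>1/K\<close>, so \<open>|p|\<^sup>2\<close> has period \<open>1/K\<close>.  Translating the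
  integral of \<open>|p g|\<^sup>2\<close> by \<open>0, 1/K, ..., (K-1)/K\<close> and averaging therefore gives
  \<open>\<integral>|p g|\<^sup>2 = \<integral>|p|\<^sup>2 G\<close> (\<open>integral_trig_sum_periodization\<close>).  With Parseval's identity, the lower
  Riesz bound \<open>A\<close> for the residue class becomes the statement \<open>\<integral>|p|\<^sup>2 (G - A) \<ge> 0\<close> for all such \<open>p\<close>.

  If \<open>G \<ge> \<epsilon>\<close> almost everywhere, this holds with \<open>A = \<epsilon>\<close> for every residue class, and the upper
  Riesz bound comes from the boundedness of \<open>g\<close>; so (2) implies (1).

  For the converse the residue class of \<open>0\<close> suffices.  Its trigonometric polynomials are the
  polynomials in \<open>z\<close> and its conjugate at the point \<open>z = exp(2 \<pi> i K t)\<close> of the unit circle, so by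
  the Stone-Weierstrass theorem \<open>|p|\<^sup>2\<close> can approximate the indicator of any closed subset of the
  circle.  In the limit the integral of \<open>G - A\<close> over the preimage of a closed set is nonnegative
  (\<open>integral_closed_arc_nonneg\<close>).  If \<open>G < A\<close> held on a set of positive measure, then, by
  inner regularity, it would hold on a compact set \<open>T\<close> of positive measure, and, by periodicity,
  on the preimage of the image of \<open>T\<close> in the circle; the integral over that preimage would be
  negative (\<open>periodization_lower_bound\<close>).

  Conditions (2) and (3) are two ways to say that on almost every orbit of translation by \<open>1/K\<close>
  one of the \<open>K\<close> values of \<open>|g|\<close> is not small.  Given (2), almost every point \<open>t\<close> of \<open>[0, 1/K]\<close>
  is assigned to the first \<open>k\<close> for which \<open>|g(t + k/K)|\<close> is at least \<open>sqrt \<epsilon>\<close>.  Given (3), one summand of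
  \<open>K G\<close> is at least \<open>\<epsilon>\<^sup>2\<close> at almost every point.
\<close>

section \<open>Null sets and measurable sets of periodic predicates\<close>

lemma AE_lebesgue_iff_negligible: "(AE t in lebesgue. P t) \<longleftrightarrow> negligible {t. \<not> P t}"
  by (simp add: completion.AE_iff_null_sets negligible_iff_null_sets)

lemma AE_unit_iff_negligible: "(AE t in unit_leb. P t) \<longleftrightarrow> negligible {t\<in>{0..1}. \<not> P t}"
proof -
  have "(AE t in unit_leb. P t) \<longleftrightarrow> (AE t in lebesgue. t \<in> {0..1} \<longrightarrow> P t)"
    by (rule AE_restrict_space_iff) simp
  also have "\<dots> \<longleftrightarrow> negligible {t\<in>{0..1}. \<not> P t}"
    by (simp add: AE_lebesgue_iff_negligible)
  finally show ?thesis .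
qed

lemma AE_lebesgue_translate:
  fixes P :: "real \<Rightarrow> bool"
  assumes "AE t in lebesgue. P t"
  shows "AE t in lebesgue. P (t + c)"
proof -
  have "{t. \<not> P (t + c)} = (+) (- c) ` {t. \<not> P t}"
    by (force simp: image_iff intro: exI[of _ "_ + c"])
  then show ?thesis
    using assms by (simp add: AE_lebesgue_iff_negligible negligible_translation del: uminus_add_conv_diff add_uminus_conv_diff)
qed

text \<open>
  This transfers measurability and negligibility from one period to the whole line: countably many
  translates of the part in \<open>[0, c)\<close> make up the set.
\<close>

lemma periodic_decomposition:
  fixes R :: "real \<Rightarrow> bool"
  assumes c: "c > 0" and R: "\<And>t. R (t + c) \<longleftrightarrow> R t"
  shows "{t. R t} = (\<Union>n::int. (+) (of_int n * c) ` {t\<in>{0..<c}. R t})"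
proof -
  interpret periodic_fun_simple R c by standard (rule R)
  have "t \<in> (\<Union>n::int. (+) (of_int n * c) ` {t\<in>{0..<c}. R t})" if "R t" for t
  proof
    define n where "n = \<lfloor>t / c\<rfloor>"
    have "of_int n \<le> t / c" "t / c < of_int n + 1"
      by (auto simp: n_def)
    then have "of_int n * c \<le> t" "t < of_int n * c + c"
      using c by (auto simp: field_simps)
    moreover have "R (t - of_int n * c)"
      using that minus_of_int by simp
    ultimately show "t \<in> (+) (of_int n * c) ` {t\<in>{0..<c}. R t}"
      by (intro image_eqI[of _ _ "t - of_int n * c"]) auto
  qed simp
  moreover have "R (of_int n * c + t)" if "R t" for t n
    using that plus_of_int[of t n] by (simp add: add.commute)
  ultimately show ?thesis by auto
qed

lemma negligible_periodic:
  fixes R :: "real \<Rightarrow> bool"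
  assumes "c > 0" "\<And>t. R (t + c) \<longleftrightarrow> R t" "negligible {t\<in>{0..c}. R t}"
  shows "negligible {t. R t}"
  unfolding periodic_decomposition[OF assms(1), of R, OF assms(2)]
  by (intro negligible_countable_Union)
     (auto intro!: negligible_translation intro: negligible_subset[OF assms(3)])

lemma sets_lebesgue_periodic:
  fixes R :: "real \<Rightarrow> bool"
  assumes "c > 0" "\<And>t. R (t + c) \<longleftrightarrow> R t" "{t\<in>{0..<c}. R t} \<in> sets lebesgue"
  shows "{t. R t} \<in> sets lebesgue"
proof -
  have "(+) (of_int n * c) ` {t\<in>{0..<c}. R t} \<in> sets lebesgue" for n
    by (rule lebesgue_sets_translation) (rule assms(3))
  then show ?thesis
    unfolding periodic_decomposition[OF assms(1), of R, OF assms(2)] by blast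
qed

lemma measurable_translation_lebesgue [measurable]:
  "(\<lambda>t::real. t + c) \<in> lebesgue \<rightarrow>\<^sub>M lebesgue"
  using lebesgue_affine_measurable[of "\<lambda>_. 1::real" c] by (simp add: add.commute)

lemma frac_add_1: "frac (t + 1) = frac (t::real)"
  by (rule frac_1_eq)

lemma frac_id: "0 \<le> t \<Longrightarrow> t < 1 \<Longrightarrow> frac t = (t::real)"
  by (simp add: frac_eq)

lemma measurable_frac_unit: "(frac :: real \<Rightarrow> real) \<in> lebesgue \<rightarrow>\<^sub>M unit_leb"
proof (rule measurableI)
  fix A assume "A \<in> sets unit_leb"
  then have A: "A \<in> sets lebesgue"
    by (simp add: sets_restrict_space_iff)
  have "{t\<in>{0..<1}. frac t \<in> A} = A \<inter> {0..<1}"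
    by (auto simp: frac_id)
  moreover have "A \<inter> {0..<1} \<in> sets lebesgue"
    using A by (intro sets.Int) auto
  ultimately have "{t::real. frac t \<in> A} \<in> sets lebesgue"
    using sets_lebesgue_periodic[of 1 "\<lambda>t. frac t \<in> A"] by (simp only: frac_add_1 simp_thms zero_less_one)
  then show "frac -` A \<inter> space lebesgue \<in> sets lebesgue"
    by (simp add: vimage_def)
qed (simp add: less_imp_le[OF frac_lt_1])

text \<open>
  The point \<open>1\<close> belongs to the unit interval but is not a value of \<open>frac\<close>; being a null set, it
  makes no difference.
\<close>

lemma AE_unit_imp_AE_frac:
  assumes "AE t in unit_leb. P t"
  shows "AE t in lebesgue. P (frac t)"
  unfolding AE_lebesgue_iff_negligible
proof (rule negligible_periodic[of 1 "\<lambda>t. \<not> P (frac t)"])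
  have "{t\<in>{0..1}. \<not> P (frac t)} \<subseteq> insert 1 {t\<in>{0..1}. \<not> P t}"
  proof
    fix t assume t: "t \<in> {t\<in>{0..1}. \<not> P (frac t)}"
    show "t \<in> insert 1 {t\<in>{0..1}. \<not> P t}"
      using t frac_id[of t] by (cases "t = 1") auto
  qed
  then show "negligible {t\<in>{0..1}. \<not> P (frac t)}"
    by (rule negligible_subset[rotated])
       (use assms in \<open>simp only: AE_unit_iff_negligible negligible_insert\<close>)
qed (simp_all only: frac_add_1 zero_less_one)

lemma AE_unit_frac_eq: "AE t in unit_leb. frac t = t"
  unfolding AE_unit_iff_negligible
proof (rule negligible_subset[of "{1}"])
  show "{t\<in>{0..1}. frac t \<noteq> t} \<subseteq> {1::real}"
    by (clarsimp simp: frac_eq)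
qed simp

lemma AE_lebesgue_imp_unit: "AE t in lebesgue. P t \<Longrightarrow> AE t in unit_leb. P t"
  unfolding AE_unit_iff_negligible AE_lebesgue_iff_negligible
  by (erule negligible_subset) auto

section \<open>The periodization of the symbol\<close>

definition periodization :: "(real \<Rightarrow> complex) \<Rightarrow> nat \<Rightarrow> real \<Rightarrow> real" where
  "periodization g K t = (1 / real K) * (\<Sum>k<K. (cmod (periodic_ext g (t - real k / real K)))\<^sup>2)"

lemma periodic_ext_add_1: "periodic_ext g (t + 1) = periodic_ext g t"
  by (simp add: periodic_ext_def frac_add_1)

text \<open>
  The difference of the two sides telescopes to \<open>f (t + 1) - f t\<close>.
\<close>

lemma sum_shift_cyclic:
  fixes f :: "real \<Rightarrow> real"
  assumes "\<And>t. f (t + 1) = f t" and "K > 0"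
  shows "(\<Sum>k<K. f (t + 1 / real K + real k / real K)) = (\<Sum>k<K. f (t + real k / real K))"
proof -
  have "(\<Sum>k<K. f (t + 1 / real K + real k / real K)) - (\<Sum>k<K. f (t + real k / real K))
     = (\<Sum>k<K. f (t + real (Suc k) / real K) - f (t + real k / real K))"
    by (simp add: sum_subtractf add_divide_distrib add.assoc)
  also have "\<dots> = f (t + 1) - f t"
    using \<open>K > 0\<close> by (subst sum_lessThan_telescope) auto
  finally show ?thesis using assms by simp
qed

text \<open>
  Modulo the period, the shifts \<open>-k/K\<close> and \<open>k/K\<close> run through the same points.  The reversal
  \<open>k \<mapsto> K - 1 - k\<close> shows it up to a cyclic shift by \<open>1/K\<close>.
\<close>

lemma sum_reflect_cyclic:
  fixes f :: "real \<Rightarrow> real"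
  assumes f: "\<And>t. f (t + 1) = f t" and "K > 0"
  shows "(\<Sum>k<K. f (t - real k / real K)) = (\<Sum>k<K. f (t + real k / real K))"
proof -
  have "(\<Sum>k<K. f (t - real k / real K)) = (\<Sum>k<K. f (t - real (K - Suc k) / real K))"
    by (rule sum.nat_diff_reindex[symmetric])
  also have "\<dots> = (\<Sum>k<K. f (t + 1 / real K + real k / real K))"
  proof (rule sum.cong)
    fix k assume "k \<in> {..<K}"
    then have "t + 1 / real K + real k / real K = (t - real (K - Suc k) / real K) + 1"
      by (auto simp: field_simps of_nat_diff)
    then show "f (t - real (K - Suc k) / real K) = f (t + 1 / real K + real k / real K)"
      by (simp only: f)
  qed simp
  also have "\<dots> = (\<Sum>k<K. f (t + real k / real K))"
    by (rule sum_shift_cyclic[of f, OF f \<open>K > 0\<close>])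
  finally show ?thesis .
qed

text \<open>
  With forward shifts the period \<open>1/K\<close> is visible at once, and the points \<open>t + k/K\<close> with \<open>t\<close> in
  \<open>[0, 1/K]\<close> are those of the sets \<open>E\<^sub>k\<close> in condition (3).
\<close>

lemma periodization_plus:
  assumes "K > 0"
  shows "periodization g K t = (1 / real K) * (\<Sum>k<K. (cmod (periodic_ext g (t + real k / real K)))\<^sup>2)"
  unfolding periodization_def
  by (subst sum_reflect_cyclic[of "\<lambda>t. (cmod (periodic_ext g t))\<^sup>2"])
     (use assms in \<open>auto simp: periodic_ext_add_1\<close>)

lemma periodization_periodic:
  assumes "K > 0"
  shows "periodization g K (t + 1 / real K) = periodization g K t"
  unfolding periodization_plus[OF assms]
  by (subst sum_shift_cyclic[of "\<lambda>t. (cmod (periodic_ext g t))\<^sup>2"])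
     (use assms in \<open>auto simp: periodic_ext_add_1\<close>)

lemma measurable_periodic_ext:
  assumes "g \<in> Linf_unit"
  shows "periodic_ext g \<in> borel_measurable lebesgue"
  using measurable_compose[OF measurable_frac_unit, of g borel] assms
  unfolding periodic_ext_def Linf_unit_def by auto

lemma measurable_periodic_ext_translate:
  assumes "g \<in> Linf_unit"
  shows "(\<lambda>t. periodic_ext g (t + c)) \<in> borel_measurable lebesgue"
    "(\<lambda>t. periodic_ext g (t - c)) \<in> borel_measurable lebesgue"
  using measurable_compose[OF measurable_translation_lebesgue measurable_periodic_ext[OF assms], of c]
    measurable_compose[OF measurable_translation_lebesgue measurable_periodic_ext[OF assms], of "-c"]
  by simp_all

lemma measurable_periodization:
  assumes "g \<in> Linf_unit"
  shows "periodization g K \<in> borel_measurable lebesgue"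
  unfolding periodization_def using measurable_periodic_ext_translate(2)[OF assms] by measurable

lemma Linf_bound:
  assumes "g \<in> Linf_unit"
  obtains C where "C > 0" "\<And>c. AE t in unit_leb. cmod (periodic_ext g (t - c)) \<le> C"
    "AE t in unit_leb. cmod (g t) \<le> C"
proof -
  obtain C where C: "AE t in unit_leb. cmod (g t) \<le> C"
    using assms by (auto simp: Linf_unit_def)
  \<comment> \<open>a positive bound is needed for the upper Riesz constant\<close>
  define D where "D = max C 1"
  have D: "AE t in unit_leb. cmod (g t) \<le> D"
    using C by eventually_elim (auto simp: D_def)
  have "AE t in unit_leb. cmod (periodic_ext g (t - c)) \<le> D" for c
    using AE_lebesgue_imp_unit[OF AE_lebesgue_translate[OF AE_unit_imp_AE_frac[OF D], of "-c"]]
    by (simp add: periodic_ext_def)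
  then show thesis using that[of D] D by (auto simp: D_def)
qed

section \<open>Trigonometric sums and their weighted norms\<close>

text \<open>
  The part of the translated integral over \<open>[-c, 0]\<close> is moved to \<open>[1 - c, 1]\<close> by periodicity.
\<close>

lemma integral_periodic_translate:
  fixes f :: "real \<Rightarrow> real"
  assumes per: "\<And>t. f (t + 1) = f t" and int: "f integrable_on {0..1}" and c: "0 \<le> c" "c \<le> 1"
  shows "integral {0..1} (\<lambda>t. f (t - c)) = integral {0..1} f"
proof -
  have "f integrable_on {-1..0}"
    using integrable_shift_real_ivl[OF int, of 1] by (simp add: per)
  with int have int2: "f integrable_on {-1..1}"
    by (intro Henstock_Kurzweil_Integration.integrable_combine[of "-1" 0 1]) auto
  have "integral {0..1} (\<lambda>t. f (t - c)) = integral {-c..1-c} f"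
    using integral_shift_real_ivl[of "-c" "-c" "1-c" f] by simp
  also have "\<dots> = integral {-c..0} f + integral {0..1-c} f"
    by (rule Henstock_Kurzweil_Integration.integral_combine[symmetric]) (use c int2 in \<open>auto intro: integrable_subinterval_real\<close>)
  also have "integral {-c..0} f = integral {1-c..1} f"
    using integral_shift_real_ivl[of "1-c" 1 1 f] by (simp add: per)
  also have "integral {1-c..1} f + integral {0..1-c} f = integral {0..1} f"
    by (subst add.commute, rule Henstock_Kurzweil_Integration.integral_combine) (use c int in auto)
  finally show ?thesis .
qed

lemma char_fun_cis: "char_fun n t = cis (2 * pi * (of_int n * t))"
  by (simp add: char_fun_def cis_conv_exp algebra_simps)

lemma char_fun_add: "char_fun (m + n) t = char_fun m t * char_fun n t"
  by (simp add: char_fun_cis cis_mult algebra_simps)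

lemma cnj_char_fun: "cnj (char_fun n t) = char_fun (- n) t"
  by (simp add: char_fun_cis cis_cnj)

lemma norm_char_fun [simp]: "cmod (char_fun n t) = 1"
  by (simp add: char_fun_cis)

lemma char_fun_0 [simp]: "char_fun 0 t = 1"
  by (simp add: char_fun_def)

lemma char_fun_of_int [simp]: "char_fun n (of_int m) = 1"
  by (simp add: char_fun_cis cis_multiple_2pi flip: of_int_mult)

lemma char_fun_translate: "char_fun n (t + s) = char_fun n t * char_fun n s"
  by (simp add: char_fun_cis cis_mult algebra_simps)

lemma char_fun_period: "char_fun n (t + 1) = char_fun n t"
  using char_fun_of_int[of n 1] by (simp add: char_fun_translate)

lemma continuous_char_fun: "continuous_on S (char_fun n)"
  unfolding char_fun_def by (intro continuous_intros)

lemma measurable_char_fun [measurable]: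
  "char_fun n \<in> borel_measurable unit_leb"
  by (rule continuous_imp_measurable_on_sets_lebesgue[OF continuous_char_fun]) simp

interpretation unit_leb: finite_measure unit_leb
  by (rule finite_measure_lebesgue_on) simp

lemma integral_char_fun: "(\<integral>t. char_fun n t \<partial>unit_leb) = (if n = 0 then 1 else 0)"
proof (cases "n = 0")
  case True
  have "measure unit_leb {0..1} = 1"
    by (simp add: measure_restrict_space)
  then show ?thesis using True by simp
next
  case False
  define c :: complex where "c = 2 * of_real pi * \<i> * of_int n"
  have c: "c \<noteq> 0" using False by (simp add: c_def)
  have e: "char_fun n = (\<lambda>t. exp (c * of_real t))"
    by (simp add: char_fun_def c_def)
  have "((\<lambda>t. exp (c * of_real t)) has_integral
      (exp (c * of_real 1) / c - exp (c * of_real 0) / c)) {0..1}"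
  proof (rule fundamental_theorem_of_calculus)
    fix x :: real
    have "((\<lambda>z. exp (c * z) / c) has_field_derivative exp (c * of_real x)) (at (of_real x))"
      using c by (auto intro!: derivative_eq_intros)
    then show "((\<lambda>t. exp (c * of_real t) / c) has_vector_derivative exp (c * of_real x)) (at x within {0..1})"
      by (rule has_vector_derivative_real_field)
  qed simp
  moreover have "exp (c * of_real 1) = 1"
    using char_fun_of_int[of n 1] by (simp add: e)
  ultimately have "integral {0..1} (char_fun n) = 0"
    using c by (simp add: e integral_unique)
  moreover have "integrable unit_leb (char_fun n)"
    by (rule unit_leb.integrable_const_bound[of _ 1]) auto
  ultimately show ?thesis using False
    by (subst lebesgue_integral_eq_integral) auto
qed

definition trig_sum :: "int set \<Rightarrow> (int \<Rightarrow> complex) \<Rightarrow> real \<Rightarrow> complex" where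
  "trig_sum F a t = (\<Sum>n\<in>F. a n * char_fun n t)"

lemma measurable_trig_sum [measurable]:
  "trig_sum F a \<in> borel_measurable unit_leb"
  unfolding trig_sum_def by measurable

lemma norm_trig_sum_le: "cmod (trig_sum F a t) \<le> (\<Sum>n\<in>F. cmod (a n))"
  unfolding trig_sum_def by (rule order_trans[OF norm_sum]) (simp add: norm_mult)

lemma trig_sum_period: "trig_sum F a (t + 1) = trig_sum F a t"
  by (simp add: trig_sum_def char_fun_period)

lemma parseval:
  assumes "finite F"
  shows "(\<integral>t. (cmod (trig_sum F a t))\<^sup>2 \<partial>unit_leb) = (\<Sum>n\<in>F. (cmod (a n))\<^sup>2)"
proof -
  have int: "integrable unit_leb (char_fun n)" for n
    by (rule unit_leb.integrable_const_bound[of _ 1]) auto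
  have "complex_of_real (\<integral>t. (cmod (trig_sum F a t))\<^sup>2 \<partial>unit_leb)
      = (\<integral>t. complex_of_real ((cmod (trig_sum F a t))\<^sup>2) \<partial>unit_leb)"
    by (rule integral_complex_of_real[symmetric])
  also have "\<dots> = (\<integral>t. (\<Sum>n\<in>F. \<Sum>m\<in>F. a n * cnj (a m) * char_fun (n - m) t) \<partial>unit_leb)"
  proof (rule Bochner_Integration.integral_cong[OF refl])
    fix t
    have "char_fun (n - m) t = char_fun n t * cnj (char_fun m t)" for n m
      using char_fun_add[of n "-m" t] by (simp add: cnj_char_fun)
    then show "complex_of_real ((cmod (trig_sum F a t))\<^sup>2)
        = (\<Sum>n\<in>F. \<Sum>m\<in>F. a n * cnj (a m) * char_fun (n - m) t)"
      unfolding complex_norm_square by (simp add: trig_sum_def sum_product cnj_sum mult_ac)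
  qed
  also have "\<dots> = (\<Sum>n\<in>F. \<Sum>m\<in>F. a n * cnj (a m) * (if n = m then 1 else 0))"
    using int by (simp add: Bochner_Integration.integral_sum Bochner_Integration.integrable_sum integral_char_fun)
  also have "\<dots> = (\<Sum>n\<in>F. a n * cnj (a n))"
    using assms by (simp add: if_distrib[of "\<lambda>x. _ * x"] cong: if_cong)
  also have "\<dots> = complex_of_real (\<Sum>n\<in>F. (cmod (a n))\<^sup>2)"
    unfolding of_real_sum complex_norm_square ..
  finally show ?thesis by (simp only: of_real_eq_iff)
qed

text \<open>
  The frequencies lie in one residue class modulo \<open>K\<close>, so all exponentials are multiplied by the
  same unimodular factor.
\<close>

lemma norm_trig_sum_translate:
  assumes F: "F \<subseteq> {n * int K + int k |n. True}" and "K > 0"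
  shows "cmod (trig_sum F a (t - real j / real K)) = cmod (trig_sum F a t)"
proof -
  define w where "w = char_fun (int k) (- (real j / real K))"
  have "char_fun n (t - real j / real K) = w * char_fun n t" if nF: "n \<in> F" for n
  proof -
    obtain m where n: "n = m * int K + int k" using F nF by blast
    have "char_fun (m * int K) (- (real j / real K)) = char_fun m (of_int (- int j))"
      using \<open>K > 0\<close> by (simp add: char_fun_cis)
    then have "char_fun n (- (real j / real K)) = w"
      by (simp only: n char_fun_add w_def char_fun_of_int) simp
    then show ?thesis
      using char_fun_translate[of n t "- (real j / real K)"] by (simp add: mult.commute)
  qed
  then have "trig_sum F a (t - real j / real K) = w * trig_sum F a t"
    by (simp add: trig_sum_def sum_distrib_left mult.left_commute cong: sum.cong)
  then show ?thesis by (simp add: norm_mult w_def)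
qed

lemma integrable_trig_sum_periodic_ext:
  assumes "g \<in> Linf_unit"
  shows "integrable unit_leb (\<lambda>t. (cmod (trig_sum F a t))\<^sup>2 * (cmod (periodic_ext g (t - c)))\<^sup>2)"
proof -
  obtain C where C: "C > 0" "\<And>c. AE t in unit_leb. cmod (periodic_ext g (t - c)) \<le> C"
    using Linf_bound[OF assms] by metis
  show ?thesis
  proof (rule unit_leb.integrable_const_bound)
    show "AE t in unit_leb. norm ((cmod (trig_sum F a t))\<^sup>2 * (cmod (periodic_ext g (t - c)))\<^sup>2)
        \<le> (\<Sum>n\<in>F. cmod (a n))\<^sup>2 * C\<^sup>2"
      using C(2)[of c]
      by eventually_elim
         (auto simp: norm_mult intro!: mult_mono power_mono norm_trig_sum_le)
    have "(\<lambda>t. periodic_ext g (t - c)) \<in> borel_measurable unit_leb"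
      by (rule measurable_restrict_space1) (rule measurable_periodic_ext_translate(2)[OF assms])
    then show "(\<lambda>t. (cmod (trig_sum F a t))\<^sup>2 * (cmod (periodic_ext g (t - c)))\<^sup>2) \<in> borel_measurable unit_leb"
      by measurable
  qed
qed

text \<open>
  Translation by \<open>j/K\<close> preserves both \<open>|p|\<close> and the integral over a period, so every translate of
  \<open>|g|\<^sup>2\<close> may replace \<open>|g|\<^sup>2\<close>; the claim is the average of these \<open>K\<close> identities.
\<close>

lemma integral_trig_sum_periodization:
  assumes g: "g \<in> Linf_unit" and F: "F \<subseteq> {n * int K + int k |n. True}" and K: "K > 0"
  shows "(\<integral>t. (cmod (trig_sum F a t * g t))\<^sup>2 \<partial>unit_leb)
    = (\<integral>t. (cmod (trig_sum F a t))\<^sup>2 * periodization g K t \<partial>unit_leb)"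
proof -
  have [measurable]: "g \<in> borel_measurable unit_leb"
    using g by (simp add: Linf_unit_def)
  define f where "f = (\<lambda>t. (cmod (trig_sum F a t))\<^sup>2 * (cmod (periodic_ext g t))\<^sup>2)"
  have f0: "integrable unit_leb f"
    using integrable_trig_sum_periodic_ext[OF g, of F a 0] by (simp add: f_def)
  have fK: "f (t - real j / real K) = (cmod (trig_sum F a t))\<^sup>2 * (cmod (periodic_ext g (t - real j / real K)))\<^sup>2" for t j
    by (simp add: f_def norm_trig_sum_translate[OF F K])
  have fj: "integrable unit_leb (\<lambda>t. f (t - real j / real K))" for j
    unfolding fK by (rule integrable_trig_sum_periodic_ext[OF g])
  have shift: "(\<integral>t. f (t - real j / real K) \<partial>unit_leb) = (\<integral>t. f t \<partial>unit_leb)" if "j < K" for j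
  proof -
    have "integral {0..1} (\<lambda>t. f (t - real j / real K)) = integral {0..1} f"
    proof (rule integral_periodic_translate)
      show "f integrable_on {0..1}"
        using has_integral_integral_lebesgue_on[OF f0] by auto
      show "f (t + 1) = f t" for t
        by (simp add: f_def trig_sum_period periodic_ext_add_1)
    qed (use that in auto)
    then show ?thesis
      using fj[of j] f0 by (simp add: lebesgue_integral_eq_integral)
  qed
  have "(\<integral>t. (cmod (trig_sum F a t))\<^sup>2 * periodization g K t \<partial>unit_leb)
     = (\<integral>t. (1 / real K) * (\<Sum>j<K. f (t - real j / real K)) \<partial>unit_leb)"
    by (simp add: periodization_def fK sum_distrib_left mult_ac)
  also have "\<dots> = (1 / real K) * (\<Sum>j<K. \<integral>t. f (t - real j / real K) \<partial>unit_leb)"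
    using fj by (simp add: Bochner_Integration.integral_sum)
  also have "\<dots> = (\<integral>t. f t \<partial>unit_leb)"
    using shift K by simp
  also have "\<dots> = (\<integral>t. (cmod (trig_sum F a t * g t))\<^sup>2 \<partial>unit_leb)"
  proof (rule integral_cong_AE)
    show "(\<lambda>t. (cmod (trig_sum F a t * g t))\<^sup>2) \<in> borel_measurable unit_leb"
      by measurable
    show "AE t in unit_leb. f t = (cmod (trig_sum F a t * g t))\<^sup>2"
      using AE_unit_frac_eq
      by eventually_elim (simp add: f_def periodic_ext_def norm_mult power_mult_distrib)
  qed (use f0 in auto)
  finally show ?thesis by simp
qed

lemma L2_norm_toeplitz_trig_sum:
  "(L2_unit_norm (\<lambda>t. \<Sum>n\<in>F. a n * toeplitz_op g (char_fun n) t))\<^sup>2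
    = (\<integral>t. (cmod (trig_sum F a t * g t))\<^sup>2 \<partial>unit_leb)"
  by (simp add: L2_unit_norm_def toeplitz_op_def trig_sum_def sum_distrib_right mult.assoc)

section \<open>Approximating indicators of closed subsets of the circle\<close>

text \<open>
  The trigonometric polynomials of period \<open>1/K\<close>, with the coefficients hidden, so that closure
  under the ring operations can be stated.
\<close>

definition trig_poly :: "nat \<Rightarrow> (real \<Rightarrow> complex) \<Rightarrow> bool" where
  "trig_poly K p \<longleftrightarrow> (\<exists>F a. finite F \<and> (\<forall>n\<in>F. int K dvd n) \<and> (\<forall>t. p t = trig_sum F a t))"

lemma trig_poly_monomial:
  assumes "int K dvd n"
  shows "trig_poly K (\<lambda>t. c * char_fun n t)"
  unfolding trig_poly_def
  by (rule exI[of _ "{n}"], rule exI[of _ "\<lambda>_. c"]) (use assms in \<open>simp add: trig_sum_def\<close>)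

lemma trig_poly_add:
  assumes "trig_poly K p" "trig_poly K q"
  shows "trig_poly K (\<lambda>t. p t + q t)"
proof -
  obtain F a where F: "finite F" "\<forall>n\<in>F. int K dvd n" "\<forall>t. p t = trig_sum F a t"
    using assms(1) unfolding trig_poly_def by blast
  obtain H b where H: "finite H" "\<forall>n\<in>H. int K dvd n" "\<forall>t. q t = trig_sum H b t"
    using assms(2) unfolding trig_poly_def by blast
  define a' where "a' n = (if n \<in> F then a n else 0)" for n
  define b' where "b' n = (if n \<in> H then b n else 0)" for n
  have "trig_sum F a t = (\<Sum>n\<in>F \<union> H. a' n * char_fun n t)" for t
    unfolding trig_sum_def by (rule sum.mono_neutral_cong_left) (use F H in \<open>auto simp: a'_def\<close>)
  moreover have "trig_sum H b t = (\<Sum>n\<in>F \<union> H. b' n * char_fun n t)" for t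
    unfolding trig_sum_def by (rule sum.mono_neutral_cong_left) (use F H in \<open>auto simp: b'_def\<close>)
  ultimately have "p t + q t = trig_sum (F \<union> H) (\<lambda>n. a' n + b' n) t" for t
    using F(3) H(3) by (simp add: trig_sum_def sum.distrib distrib_right)
  moreover have "finite (F \<union> H)" "\<forall>n\<in>F \<union> H. int K dvd n"
    using F H by auto
  ultimately show ?thesis
    unfolding trig_poly_def by blast
qed

lemma trig_poly_sum:
  assumes "finite I" "\<And>i. i \<in> I \<Longrightarrow> trig_poly K (f i)"
  shows "trig_poly K (\<lambda>t. \<Sum>i\<in>I. f i t)"
  using assms
proof (induction I rule: finite_induct)
  case empty
  show ?case using trig_poly_monomial[of K 0 0] by simp
next
  case (insert i I)
  then show ?case by (simp add: trig_poly_add)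
qed

lemma trig_poly_mult:
  assumes "trig_poly K p" "trig_poly K q"
  shows "trig_poly K (\<lambda>t. p t * q t)"
proof -
  obtain F a where F: "finite F" "\<forall>n\<in>F. int K dvd n" "\<forall>t. p t = trig_sum F a t"
    using assms(1) unfolding trig_poly_def by blast
  obtain H b where H: "finite H" "\<forall>n\<in>H. int K dvd n" "\<forall>t. q t = trig_sum H b t"
    using assms(2) unfolding trig_poly_def by blast
  have "trig_poly K (\<lambda>t. \<Sum>n\<in>F. \<Sum>m\<in>H. (a n * b m) * char_fun (n + m) t)"
    using F H by (intro trig_poly_sum trig_poly_monomial dvd_add) auto
  also have "(\<lambda>t. \<Sum>n\<in>F. \<Sum>m\<in>H. (a n * b m) * char_fun (n + m) t) = (\<lambda>t. p t * q t)"
    using F(3) H(3) by (simp add: trig_sum_def sum_product char_fun_add mult_ac)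
  finally show ?thesis .
qed

text \<open>
  A real-linear functional of \<open>z\<close> is a complex combination of \<open>z\<close> and its conjugate, which on the circle
  are the exponentials of frequency \<open>K\<close> and \<open>-K\<close>; the rest is closure under sums and products.
\<close>

lemma real_polynomial_function_circle:
  assumes "real_polynomial_function f"
  shows "trig_poly K (\<lambda>t. complex_of_real (f (char_fun (int K) t)))"
  using assms
proof (induction rule: real_polynomial_function.induct)
  case (linear f)
  interpret f: bounded_linear f by fact
  \<comment> \<open>the coefficients obtained from \<open>Re z = (z + cnj z) / 2\<close> and \<open>Im z = (z - cnj z) / (2 * \<i>)\<close>\<close>
  define \<alpha> where "\<alpha> = (complex_of_real (f 1) - \<i> * f \<i>) / 2"
  define \<beta> where "\<beta> = (complex_of_real (f 1) + \<i> * f \<i>) / 2"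
  have "complex_of_real (f z) = \<alpha> * z + \<beta> * cnj z" for z
  proof -
    have "z = Re z *\<^sub>R 1 + Im z *\<^sub>R \<i>"
      by (simp add: complex_eq_iff)
    then have "f z = Re z * f 1 + Im z * f \<i>"
      by (metis f.add f.scaleR real_scaleR_def)
    then show ?thesis
      by (simp add: \<alpha>_def \<beta>_def complex_eq_iff field_simps)
  qed
  then have "(\<lambda>t. complex_of_real (f (char_fun (int K) t)))
      = (\<lambda>t. \<alpha> * char_fun (int K) t + \<beta> * char_fun (- int K) t)"
    by (simp add: cnj_char_fun)
  then show ?case
    by (simp only:) (intro trig_poly_add trig_poly_monomial, auto)
next
  case (const c)
  show ?case using trig_poly_monomial[of K 0 "of_real c"] by simp
next
  case (add f g)
  then show ?case by (simp add: trig_poly_add)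
next
  case (mult f g)
  then show ?case by (simp add: trig_poly_mult)
qed

lemma periodization_bounded:
  assumes "g \<in> Linf_unit" "K > 0"
  obtains M where "AE t in unit_leb. \<bar>periodization g K t\<bar> \<le> M"
proof -
  obtain C where C: "C > 0" "\<And>c. AE t in unit_leb. cmod (periodic_ext g (t - c)) \<le> C"
    using Linf_bound[OF assms(1)] by metis
  have "AE t in unit_leb. \<forall>k\<in>{..<K}. cmod (periodic_ext g (t - real k / real K)) \<le> C"
    using C(2) by (intro AE_finite_allI) auto
  then have "AE t in unit_leb. \<bar>periodization g K t\<bar> \<le> C\<^sup>2"
  proof eventually_elim
    case (elim t)
    have "(\<Sum>k<K. (cmod (periodic_ext g (t - real k / real K)))\<^sup>2) \<le> (\<Sum>k<K. C\<^sup>2)"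
      using elim by (intro sum_mono power_mono) auto
    moreover have "0 \<le> (\<Sum>k<K. (cmod (periodic_ext g (t - real k / real K)))\<^sup>2)"
      by (intro sum_nonneg) auto
    ultimately show ?case
      using assms(2) by (simp add: periodization_def field_simps abs_if)
  qed
  then show thesis by (rule that)
qed

lemma integrable_trig_sum_sq:
  "integrable unit_leb (\<lambda>t. (cmod (trig_sum F a t))\<^sup>2)"
  by (rule unit_leb.integrable_const_bound[of _ "(\<Sum>n\<in>F. cmod (a n))\<^sup>2"])
     (auto intro!: always_eventually power_mono norm_trig_sum_le)

lemma integrable_trig_sum_sq_periodization:
  assumes g: "g \<in> Linf_unit" and K: "K > 0"
  shows "integrable unit_leb (\<lambda>t. (cmod (trig_sum F a t))\<^sup>2 * periodization g K t)"
proof -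
  have [measurable]: "periodization g K \<in> borel_measurable unit_leb"
    by (rule measurable_restrict_space1) (rule measurable_periodization[OF g])
  obtain M where M: "AE t in unit_leb. \<bar>periodization g K t\<bar> \<le> M"
    using periodization_bounded[OF g K] .
  show ?thesis
  proof (rule unit_leb.integrable_const_bound)
    show "AE t in unit_leb. norm ((cmod (trig_sum F a t))\<^sup>2 * periodization g K t) \<le> (\<Sum>n\<in>F. cmod (a n))\<^sup>2 * M"
      using M by eventually_elim
        (auto simp: abs_mult intro!: mult_mono power_mono norm_trig_sum_le)
  qed measurable
qed

text \<open>
  By its period \<open>1/K\<close>, the periodization is a function of \<open>exp(2 \<pi> i K t)\<close>.
\<close>

lemma char_fun_eq_imp_periodization_eq:
  assumes "K > 0" "char_fun (int K) t = char_fun (int K) d"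
  shows "periodization g K t = periodization g K d"
proof -
  interpret periodic_fun_simple "periodization g K" "1 / real K"
    by standard (rule periodization_periodic[OF assms(1)])
  obtain n :: int where n: "2 * of_real pi * \<i> * of_int (int K) * complex_of_real t
      = 2 * of_real pi * \<i> * of_int (int K) * complex_of_real d + of_real (of_int (2 * n) * pi) * \<i>"
    using assms(2) unfolding char_fun_def exp_eq by blast
  then have "(2 * of_real pi * \<i>) * complex_of_real (real K * t) = (2 * of_real pi * \<i>) * complex_of_real (real K * d + of_int n)"
    by (simp add: algebra_simps)
  then have "complex_of_real (real K * t) = complex_of_real (real K * d + of_int n)"
    by (subst (asm) mult_cancel_left) simp
  then have "real K * t = real K * d + of_int n"
    by (simp only: of_real_eq_iff)
  then have "t = d + of_int n * (1 / real K)"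
    using assms(1) by (simp add: field_simps)
  then show ?thesis by (simp only: plus_of_int)
qed

text \<open>
  The continuous functions \<open>max 0 (1 - m * infdist z C)\<close> decrease to the indicator of \<open>C\<close>, because
  \<open>C\<close> is closed; each is replaced by a polynomial within \<open>1/(m+1)\<close> on the circle.
\<close>

lemma circle_indicator_approx:
  fixes C :: "complex set"
  assumes "closed C" "C \<noteq> {}"
  obtains q :: "nat \<Rightarrow> complex \<Rightarrow> real" where
    "\<And>m. real_polynomial_function (q m)"
    "\<And>m z. cmod z = 1 \<Longrightarrow> \<bar>q m z\<bar> \<le> 2"
    "\<And>z. cmod z = 1 \<Longrightarrow> (\<lambda>m. q m z) \<longlonglongrightarrow> indicator C z"
proof -
  define h :: "nat \<Rightarrow> complex \<Rightarrow> real" where "h m z = max 0 (1 - real m * infdist z C)" for m z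
  have "\<exists>q. real_polynomial_function q \<and> (\<forall>z\<in>sphere 0 1. \<bar>h m z - q z\<bar> < 1 / real (Suc m))" for m
  proof -
    have "continuous_on (sphere 0 1) (h m)"
      unfolding h_def by (intro continuous_intros)
    then obtain q where "real_polynomial_function q" "\<And>z. z \<in> sphere 0 1 \<Longrightarrow> \<bar>h m z - q z\<bar> < 1 / real (Suc m)"
      by (rule Stone_Weierstrass_real_polynomial_function[OF compact_sphere, of _ _ _ "1 / real (Suc m)"]) auto
    then show ?thesis by blast
  qed
  then obtain q where q: "\<And>m. real_polynomial_function (q m)"
    "\<And>m z. cmod z = 1 \<Longrightarrow> \<bar>h m z - q m z\<bar> < 1 / real (Suc m)"
    by (metis mem_sphere_0)
  show thesis
  proof
    show "real_polynomial_function (q m)" for m by (rule q)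
    show "\<bar>q m z\<bar> \<le> 2" if "cmod z = 1" for m z
    proof -
      have "\<bar>h m z\<bar> \<le> 1" by (simp add: h_def infdist_nonneg)
      moreover have "1 / real (Suc m) \<le> 1" by simp
      ultimately show ?thesis using q(2)[OF that, of m] by linarith
    qed
    show "(\<lambda>m. q m z) \<longlonglongrightarrow> indicator C z" if z: "cmod z = 1" for z
    proof -
      have "(\<lambda>m. h m z - q m z) \<longlonglongrightarrow> 0"
        by (rule Lim_null_comparison[OF _ LIMSEQ_inverse_real_of_nat])
           (use q(2)[OF z] in \<open>auto simp: inverse_eq_divide intro!: always_eventually less_imp_le\<close>)
      moreover have "(\<lambda>m. h m z) \<longlonglongrightarrow> indicator C z"
      proof (cases "z \<in> C")
        case True
        then show ?thesis by (simp add: h_def)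
      next
        case False
        then have pos: "infdist z C > 0"
          using assms infdist_pos_not_in_closed by blast
        have "eventually (\<lambda>m. h m z = 0) sequentially"
        proof -
          obtain N where N: "1 < real N * infdist z C"
            using pos by (metis reals_Archimedean3)
          have "h m z = 0" if "m \<ge> N" for m
          proof -
            have "real N * infdist z C \<le> real m * infdist z C"
              using that pos by (intro mult_right_mono) auto
            then show ?thesis using N by (simp add: h_def)
          qed
          then show ?thesis by (auto simp: eventually_sequentially)
        qed
        then show ?thesis using False by (simp add: tendsto_eventually)
      qed
      ultimately have "(\<lambda>m. h m z - (h m z - q m z)) \<longlonglongrightarrow> indicator C z - 0"
        by (intro tendsto_diff)
      then show ?thesis by simp
    qed
  qed
qed

text \<open>
  For the polynomials \<open>q\<^sub>m\<close> of the previous lemma, \<open>q\<^sub>m(exp(2 \<pi> i K t))\<close> is a trigonometric sum, and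
  the hypothesis together with Parseval's identity says that its square has a nonnegative integral
  against \<open>G - A\<close>.  Dominated convergence carries this over to the limit, the indicator of \<open>C\<close>.
\<close>

lemma integral_closed_arc_nonneg:
  assumes g: "g \<in> Linf_unit" and K: "K > 0" and C: "closed C" "C \<noteq> {}"
    and A: "\<And>F a. finite F \<Longrightarrow> \<forall>n\<in>F. int K dvd n \<Longrightarrow>
      A * (\<Sum>n\<in>F. (cmod (a n))\<^sup>2) \<le> (\<integral>t. (cmod (trig_sum F a t))\<^sup>2 * periodization g K t \<partial>unit_leb)"
  shows "integrable unit_leb (\<lambda>t. indicat_real C (char_fun (int K) t) * (periodization g K t - A))"
    "0 \<le> (\<integral>t. indicat_real C (char_fun (int K) t) * (periodization g K t - A) \<partial>unit_leb)"
proof -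
  let ?z = "char_fun (int K)"
  obtain M where M: "AE t in unit_leb. \<bar>periodization g K t\<bar> \<le> M"
    using periodization_bounded[OF g K] .
  have [measurable]: "periodization g K \<in> borel_measurable unit_leb"
    by (rule measurable_restrict_space1) (rule measurable_periodization[OF g])
  have [measurable]: "C \<in> sets borel" using C by simp
  obtain q where q: "\<And>m. real_polynomial_function (q m)"
    "\<And>m z. cmod z = 1 \<Longrightarrow> \<bar>q m z\<bar> \<le> 2"
    "\<And>z. cmod z = 1 \<Longrightarrow> (\<lambda>m. q m z) \<longlonglongrightarrow> indicator C z"
    using circle_indicator_approx[OF C] by metis
  have qm [measurable]: "q m \<in> borel_measurable borel" for m
    using q(1)[of m] by (intro borel_measurable_continuous_onI)
      (simp add: continuous_on_polymonial_function real_polynomial_function_eq)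
  have M': "AE t in unit_leb. \<bar>periodization g K t - A\<bar> \<le> M + \<bar>A\<bar>"
    using M by eventually_elim linarith
  show "integrable unit_leb (\<lambda>t. indicat_real C (?z t) * (periodization g K t - A))"
    by (rule unit_leb.integrable_const_bound[of _ "M + \<bar>A\<bar>"])
       (use M' in \<open>eventually_elim, auto simp: indicator_def\<close>, measurable)
  have "(\<lambda>m. \<integral>t. (q m (?z t))\<^sup>2 * (periodization g K t - A) \<partial>unit_leb)
      \<longlonglongrightarrow> (\<integral>t. (indicat_real C (?z t))\<^sup>2 * (periodization g K t - A) \<partial>unit_leb)"
  proof (rule integral_dominated_convergence)
    show "AE t in unit_leb. (\<lambda>m. (q m (?z t))\<^sup>2 * (periodization g K t - A))
        \<longlonglongrightarrow> (indicat_real C (?z t))\<^sup>2 * (periodization g K t - A)"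
      by (intro always_eventually allI tendsto_intros q(3)) simp
    show "AE t in unit_leb. norm ((q m (?z t))\<^sup>2 * (periodization g K t - A)) \<le> 4 * (M + \<bar>A\<bar>)" for m
      using M'
    proof eventually_elim
      case (elim t)
      have sq: "(q m (?z t))\<^sup>2 \<le> 2\<^sup>2"
        using q(2)[of "?z t" m] by (subst abs_le_square_iff[symmetric]) simp
      then show ?case
        using mult_mono[OF sq elim] by (simp add: abs_mult)
    qed
  qed (auto simp: integrable_const)
  moreover have "0 \<le> (\<integral>t. (q m (?z t))\<^sup>2 * (periodization g K t - A) \<partial>unit_leb)" for m
  proof -
    obtain F a where F: "finite F" "\<forall>n\<in>F. int K dvd n" "\<And>t. complex_of_real (q m (?z t)) = trig_sum F a t"
      using real_polynomial_function_circle[OF q(1), of K m] unfolding trig_poly_def by blast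
    have sq: "(q m (?z t))\<^sup>2 = (cmod (trig_sum F a t))\<^sup>2" for t
      by (simp flip: F(3))
    have "(\<integral>t. (q m (?z t))\<^sup>2 * (periodization g K t - A) \<partial>unit_leb)
       = (\<integral>t. (cmod (trig_sum F a t))\<^sup>2 * periodization g K t \<partial>unit_leb)
         - A * (\<integral>t. (cmod (trig_sum F a t))\<^sup>2 \<partial>unit_leb)"
      using integrable_trig_sum_sq[of F a] integrable_trig_sum_sq_periodization[OF g K, of F a]
      by (simp add: sq right_diff_distrib mult.commute[of _ A])
    then show ?thesis using A[OF F(1,2), of a] parseval[OF F(1), of a] by simp
  qed
  ultimately have "0 \<le> (\<integral>t. (indicat_real C (?z t))\<^sup>2 * (periodization g K t - A) \<partial>unit_leb)"
    by (intro LIMSEQ_le_const) auto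
  moreover have "(indicat_real C z)\<^sup>2 = indicat_real C z" for z
    by (simp add: indicator_def)
  ultimately show "0 \<le> (\<integral>t. indicat_real C (?z t) * (periodization g K t - A) \<partial>unit_leb)"
    by simp
qed

section \<open>The uniform Feichtinger property and the periodization\<close>

text \<open>
  Inner regularity reduces the claim to closed subsets \<open>T\<close> of \<open>[0, 1]\<close> on which \<open>G < A\<close>.  On the set of
  \<open>t\<close> with \<open>exp(2 \<pi> i K t)\<close> in the image of \<open>T\<close> one still has \<open>G < A\<close>, whereas the integral of
  \<open>G - A\<close> over this set is nonnegative; hence the set, and with it \<open>T\<close>, is null
  within the unit interval.
\<close>

lemma periodization_lower_bound:
  assumes g: "g \<in> Linf_unit" and K: "K > 0"
    and A: "\<And>F a. finite F \<Longrightarrow> \<forall>n\<in>F. int K dvd n \<Longrightarrow>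
      A * (\<Sum>n\<in>F. (cmod (a n))\<^sup>2) \<le> (\<integral>t. (cmod (trig_sum F a t))\<^sup>2 * periodization g K t \<partial>unit_leb)"
  shows "AE t in unit_leb. A \<le> periodization g K t"
proof -
  let ?z = "char_fun (int K)"
  define S where "S = {t\<in>{0..1}. \<not> A \<le> periodization g K t}"
  have [measurable]: "periodization g K \<in> borel_measurable lebesgue"
    by (rule measurable_periodization[OF g])
  have S: "S \<in> sets lebesgue"
  proof -
    have "{t\<in>space lebesgue. \<not> A \<le> periodization g K t} \<in> sets lebesgue" by measurable
    then have "{0..1} \<inter> {t. \<not> A \<le> periodization g K t} \<in> sets lebesgue"
      by (intro sets.Int) auto
    then show ?thesis by (simp add: S_def Int_def)
  qed
  have null: "negligible T" if T: "closed T" "T \<subseteq> S" for T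
  proof (cases "T = {}")
    case False
    have "compact T"
    proof -
      have "{0..1} \<inter> T = T" using T(2) by (auto simp: S_def)
      then show ?thesis using compact_Int_closed[OF compact_Icc[of 0 1] T(1)] by simp
    qed
    then have C: "closed (?z ` T)" "?z ` T \<noteq> {}"
      using False by (auto intro!: compact_imp_closed compact_continuous_image continuous_char_fun)
    let ?f = "\<lambda>t. indicat_real (?z ` T) (?z t) * (periodization g K t - A)"
    have neg: "?f t \<le> 0" for t
    proof (cases "?z t \<in> ?z ` T")
      case True
      then obtain d where "d \<in> T" "?z t = ?z d" by blast
      then have "periodization g K t < A"
        using char_fun_eq_imp_periodization_eq[OF K, of t d g] T by (force simp: S_def)
      then show ?thesis using True by simp
    qed simp
    note int = integral_closed_arc_nonneg[OF g K C A]
    have "0 \<le> (\<integral>t. - ?f t \<partial>unit_leb)"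
      by (rule Bochner_Integration.integral_nonneg) (simp only: neg_0_le_iff_le neg)
    moreover have "(\<integral>t. - ?f t \<partial>unit_leb) = - (\<integral>t. ?f t \<partial>unit_leb)"
      by (rule Bochner_Integration.integral_minus)
    ultimately have "(\<integral>t. - ?f t \<partial>unit_leb) = 0"
      using int(2) by linarith
    then have "AE t in unit_leb. - ?f t = 0"
      by (subst (asm) integral_nonneg_eq_0_iff_AE) (use int(1) neg in auto)
    then have "negligible {t\<in>{0..1}. \<not> - ?f t = 0}"
      by (simp only: AE_unit_iff_negligible)
    then show ?thesis
      by (rule negligible_subset) (use T in \<open>auto simp: S_def\<close>)
  qed simp
  have "emeasure lebesgue S \<le> 0"
  proof (rule ennreal_le_epsilon)
    fix e :: real assume "0 < e"
    obtain T where T: "closed T" "T \<subseteq> S" "emeasure lebesgue (S - T) < ennreal e"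
      using sets_lebesgue_inner_closed[OF S \<open>0 < e\<close>] by metis
    have "T \<in> null_sets lebesgue"
      using null[OF T(1,2)] by (simp add: negligible_iff_null_sets)
    then have "emeasure lebesgue (S - T) = emeasure lebesgue S"
      by (rule emeasure_Diff_null_set) (rule S)
    then show "emeasure lebesgue S \<le> 0 + ennreal e" using T(3) by simp
  qed
  then have "negligible S"
    using S by (simp add: negligible_iff_null_sets null_setsI)
  then show ?thesis by (simp add: AE_unit_iff_negligible S_def)
qed

lemma riesz_basic_sequence_lower:
  assumes "riesz_basic_sequence f I"
  obtains A where "A > 0" "\<And>F a. finite F \<Longrightarrow> F \<subseteq> I \<Longrightarrow>
    A * (\<Sum>i\<in>F. (cmod (a i))\<^sup>2) \<le> (L2_unit_norm (\<lambda>t. \<Sum>i\<in>F. a i * f i t))\<^sup>2"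
proof -
  obtain A B where A: "A > 0" "\<forall>F a. finite F \<longrightarrow> F \<subseteq> I \<longrightarrow>
        A * (\<Sum>i\<in>F. (cmod (a i))\<^sup>2) \<le> (L2_unit_norm (\<lambda>t. \<Sum>i\<in>F. a i * f i t))\<^sup>2 \<and>
        (L2_unit_norm (\<lambda>t. \<Sum>i\<in>F. a i * f i t))\<^sup>2 \<le> B * (\<Sum>i\<in>F. (cmod (a i))\<^sup>2)"
    using assms unfolding riesz_basic_sequence_def by (elim conjE exE)
  show thesis
    by (rule that[OF A(1)]) (rule A(2)[rule_format, THEN conjunct1])
qed

lemma uniform_feichtinger_imp_periodization_bound:
  assumes g: "g \<in> Linf_unit" and "uniform_feichtinger (toeplitz_op g)"
  shows "\<exists>K \<epsilon>. K > 0 \<and> \<epsilon> > 0 \<and> (AE t in unit_leb. periodization g K t \<ge> \<epsilon>)"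
proof -
  obtain K where K: "K > 0"
    "riesz_basic_sequence (\<lambda>n. toeplitz_op g (char_fun n)) {n * int K + int 0 |n. True}"
    using assms(2) unfolding uniform_feichtinger_def by blast
  have dvd: "F \<subseteq> {n * int K + int 0 |n. True}" if "\<forall>n\<in>F. int K dvd n" for F
  proof
    fix n assume "n \<in> F"
    then obtain m where "n = int K * m" using \<open>\<forall>n\<in>F. int K dvd n\<close> by (metis dvdE)
    then have "n = m * int K + int 0" by simp
    then show "n \<in> {n * int K + int 0 |n. True}" by blast
  qed
  obtain A where A: "A > 0" "\<And>F a. finite F \<Longrightarrow> F \<subseteq> {n * int K + int 0 |n. True} \<Longrightarrow>
        A * (\<Sum>i\<in>F. (cmod (a i))\<^sup>2)
          \<le> (L2_unit_norm (\<lambda>t. \<Sum>i\<in>F. a i * toeplitz_op g (char_fun i) t))\<^sup>2"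
    by (rule riesz_basic_sequence_lower[OF K(2)]) (rule that)
  have "AE t in unit_leb. A \<le> periodization g K t"
  proof (rule periodization_lower_bound[OF g K(1)])
    fix F a assume F: "finite F" "\<forall>n\<in>F. int K dvd n"
    show "A * (\<Sum>n\<in>F. (cmod (a n))\<^sup>2) \<le> (\<integral>t. (cmod (trig_sum F a t))\<^sup>2 * periodization g K t \<partial>unit_leb)"
      using A(2)[OF F(1) dvd[OF F(2)], of a]
      unfolding L2_norm_toeplitz_trig_sum integral_trig_sum_periodization[OF g dvd[OF F(2)] K(1)] .
  qed
  then show ?thesis using K(1) A(1) by blast
qed

lemma periodization_bound_imp_uniform_feichtinger:
  assumes g: "g \<in> Linf_unit" and K: "K > 0" and \<epsilon>: "\<epsilon> > 0"
    and lower: "AE t in unit_leb. periodization g K t \<ge> \<epsilon>"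
  shows "uniform_feichtinger (toeplitz_op g)"
proof -
  have [measurable]: "g \<in> borel_measurable unit_leb"
    using g by (simp add: Linf_unit_def)
  obtain C where C: "C > 0" "AE t in unit_leb. cmod (g t) \<le> C"
    using Linf_bound[OF g] by metis
  have L2: "toeplitz_op g (char_fun n) \<in> L2_unit" for n
  proof -
    have "integrable unit_leb (\<lambda>t. (cmod (char_fun n t * g t))\<^sup>2)"
    proof (rule unit_leb.integrable_const_bound)
      show "AE t in unit_leb. norm ((cmod (char_fun n t * g t))\<^sup>2) \<le> C\<^sup>2"
        using C(2) by eventually_elim (simp add: norm_mult power_mono)
    qed measurable
    then show ?thesis by (simp add: L2_unit_def toeplitz_op_def)
  qed
  have bounds: "\<epsilon> * (\<Sum>i\<in>F. (cmod (a i))\<^sup>2)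
        \<le> (L2_unit_norm (\<lambda>t. \<Sum>i\<in>F. a i * toeplitz_op g (char_fun i) t))\<^sup>2"
      "(L2_unit_norm (\<lambda>t. \<Sum>i\<in>F. a i * toeplitz_op g (char_fun i) t))\<^sup>2
        \<le> C\<^sup>2 * (\<Sum>i\<in>F. (cmod (a i))\<^sup>2)"
    if F: "finite F" "F \<subseteq> {n * int K + int k |n. True}" for F a k
  proof -
    note int = integrable_trig_sum_sq[of F a]
    note intG = integrable_trig_sum_sq_periodization[OF g K, of F a]
    have "\<epsilon> * (\<Sum>i\<in>F. (cmod (a i))\<^sup>2) = (\<integral>t. (cmod (trig_sum F a t))\<^sup>2 * \<epsilon> \<partial>unit_leb)"
      using parseval[OF F(1), of a] by simp
    also have "\<dots> \<le> (\<integral>t. (cmod (trig_sum F a t))\<^sup>2 * periodization g K t \<partial>unit_leb)"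
    proof (rule integral_mono_AE)
      show "AE t in unit_leb. (cmod (trig_sum F a t))\<^sup>2 * \<epsilon> \<le> (cmod (trig_sum F a t))\<^sup>2 * periodization g K t"
        using lower by eventually_elim (simp add: mult_left_mono)
    qed (use int intG in auto)
    finally show "\<epsilon> * (\<Sum>i\<in>F. (cmod (a i))\<^sup>2)
        \<le> (L2_unit_norm (\<lambda>t. \<Sum>i\<in>F. a i * toeplitz_op g (char_fun i) t))\<^sup>2"
      unfolding L2_norm_toeplitz_trig_sum integral_trig_sum_periodization[OF g F(2) K] .
    have le: "AE t in unit_leb. (cmod (trig_sum F a t * g t))\<^sup>2 \<le> (cmod (trig_sum F a t))\<^sup>2 * C\<^sup>2"
      using C(2) by eventually_elim
        (auto simp: norm_mult power_mult_distrib intro!: mult_left_mono power_mono)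
    have "(\<integral>t. (cmod (trig_sum F a t * g t))\<^sup>2 \<partial>unit_leb) \<le> (\<integral>t. (cmod (trig_sum F a t))\<^sup>2 * C\<^sup>2 \<partial>unit_leb)"
      by (rule integral_mono_AE'[OF _ le]) (use int in auto)
    also have "\<dots> = C\<^sup>2 * (\<Sum>i\<in>F. (cmod (a i))\<^sup>2)"
      using parseval[OF F(1), of a] by simp
    finally show "(L2_unit_norm (\<lambda>t. \<Sum>i\<in>F. a i * toeplitz_op g (char_fun i) t))\<^sup>2
        \<le> C\<^sup>2 * (\<Sum>i\<in>F. (cmod (a i))\<^sup>2)"
      unfolding L2_norm_toeplitz_trig_sum .
  qed
  have "riesz_basic_sequence (\<lambda>n. toeplitz_op g (char_fun n)) {n * int K + int k |n. True}" for k
    unfolding riesz_basic_sequence_def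
    by (intro conjI ballI L2, rule exI[of _ \<epsilon>], rule conjI[OF \<epsilon>], rule exI[of _ "C\<^sup>2"])
       (use C(1) bounds[of _ k] in simp)
  then show ?thesis using K unfolding uniform_feichtinger_def by blast
qed

section \<open>Selecting the sets of the tiling\<close>

definition tiling_condition :: "(real \<Rightarrow> complex) \<Rightarrow> real \<Rightarrow> nat \<Rightarrow> (nat \<Rightarrow> real set) \<Rightarrow> bool" where
  "tiling_condition g \<epsilon> K E \<longleftrightarrow>
    (\<forall>k<K. E k \<in> sets lebesgue \<and> E k \<subseteq> {real k / real K .. (real k + 1) / real K}) \<and>
    pairwise (\<lambda>j k. ae_disjoint ((\<lambda>t. t - real j / real K) ` E j)
                                ((\<lambda>t. t - real k / real K) ` E k)) {..<K} \<and>
    ae_equal (\<Union>k<K. (\<lambda>t. t - real k / real K) ` E k) {0 .. 1 / real K} \<and>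
    (AE t in lebesgue. t \<in> (\<Union>k<K. E k) \<longrightarrow> cmod (g t) \<ge> \<epsilon>)"

text \<open>
  If an average of \<open>K\<close> squares is at least \<open>\<epsilon>\<close>, one of the squares is.  Taking the least index at which
  this happens makes the sets disjoint.
\<close>

lemma periodization_bound_imp_tiling:
  assumes g: "g \<in> Linf_unit" and K: "K > 0" and \<epsilon>: "\<epsilon> > 0"
    and lower: "AE t in unit_leb. periodization g K t \<ge> \<epsilon>"
  shows "\<exists>E. tiling_condition g (sqrt \<epsilon>) K E"
proof -
  define B where "B k = {t\<in>{0..<1 / real K}. cmod (periodic_ext g (t + real k / real K)) \<ge> sqrt \<epsilon>}" for k
  define D where "D = disjointed B"
  define E where "E k = (+) (real k / real K) ` D k" for k
  have B: "B k \<in> sets lebesgue" for k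
  proof -
    have "(\<lambda>t. periodic_ext g (t + real k / real K)) \<in> borel_measurable lebesgue"
      by (rule measurable_periodic_ext_translate(1)[OF g])
    then have "{t\<in>space lebesgue. cmod (periodic_ext g (t + real k / real K)) \<ge> sqrt \<epsilon>} \<in> sets lebesgue"
      by measurable
    then have "{0..<1 / real K} \<inter> {t. cmod (periodic_ext g (t + real k / real K)) \<ge> sqrt \<epsilon>} \<in> sets lebesgue"
      by (intro sets.Int) auto
    then show ?thesis by (simp add: B_def Int_def)
  qed
  have DB: "D k \<subseteq> B k" for k
    unfolding D_def by (rule disjointed_subset)
  have D: "D k \<in> sets lebesgue" for k
    using sets.range_disjointed_sets[of B lebesgue] B by (auto simp: D_def)
  have ED: "(\<lambda>t. t - real k / real K) ` E k = D k" for k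
    by (simp add: E_def image_image)
  have UD: "(\<Union>k<K. D k) = (\<Union>k<K. B k)"
    using finite_UN_disjointed_eq[of B K] by (simp add: D_def atLeast0LessThan)
  have cover: "t \<in> (\<Union>k<K. B k)" if "\<epsilon> \<le> periodization g K t" "0 \<le> t" "t < 1 / real K" for t
  proof (rule ccontr)
    assume "t \<notin> (\<Union>k<K. B k)"
    then have small: "cmod (periodic_ext g (t + real k / real K)) < sqrt \<epsilon>" if "k < K" for k
      using that \<open>0 \<le> t\<close> \<open>t < 1 / real K\<close> by (auto simp: B_def not_le)
    have "(\<Sum>k<K. (cmod (periodic_ext g (t + real k / real K)))\<^sup>2) < (\<Sum>k<K. (sqrt \<epsilon>)\<^sup>2)"
      using K by (intro sum_strict_mono power_strict_mono small) auto
    then have "periodization g K t < \<epsilon>"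
      using K \<epsilon> by (simp add: periodization_plus field_simps)
    then show False using that(1) by simp
  qed
  have "tiling_condition g (sqrt \<epsilon>) K E"
    unfolding tiling_condition_def ED
  proof (intro conjI allI impI)
    fix k assume "k < K"
    show "E k \<in> sets lebesgue"
      unfolding E_def by (rule lebesgue_sets_translation[OF D])
    show "E k \<subseteq> {real k / real K .. (real k + 1) / real K}"
      using DB[of k] by (auto simp: E_def B_def add_divide_distrib)
  next
    have "D j \<inter> D k = {}" if "j \<noteq> k" for j k
      using disjoint_family_disjointed[of B] that by (auto simp: disjoint_family_on_def D_def)
    then show "pairwise (\<lambda>j k. ae_disjoint (D j) (D k)) {..<K}"
      by (simp add: pairwise_def ae_disjoint_def)
  next
    have "negligible {t\<in>{0..1}. \<not> \<epsilon> \<le> periodization g K t}"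
      using lower by (simp only: AE_unit_iff_negligible)
    then have "negligible (insert (1 / real K) {t\<in>{0..1}. \<not> \<epsilon> \<le> periodization g K t})"
      by simp
    then have "negligible ({0..1 / real K} - (\<Union>k<K. B k))"
    proof (rule negligible_subset)
      have out: "t = 1 / real K \<or> t \<le> 1 \<and> \<not> \<epsilon> \<le> periodization g K t"
        if t: "0 \<le> t" "t \<le> 1 / real K" "t \<notin> (\<Union>k<K. B k)" for t
      proof -
        have "1 / real K \<le> 1" using K by simp
        then show ?thesis using cover[of t] t by (cases "t = 1 / real K") auto
      qed
      show "{0..1 / real K} - (\<Union>k<K. B k) \<subseteq> insert (1 / real K) {t\<in>{0..1}. \<not> \<epsilon> \<le> periodization g K t}"
      proof
        fix t assume "t \<in> {0..1 / real K} - (\<Union>k<K. B k)"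
        then show "t \<in> insert (1 / real K) {t\<in>{0..1}. \<not> \<epsilon> \<le> periodization g K t}"
          using out[of t] by simp
      qed
    qed
    moreover have "(\<Union>k<K. B k) - {0..1 / real K} = {}"
      by (auto simp: B_def)
    ultimately show "ae_equal (\<Union>k<K. D k) {0..1 / real K}"
      unfolding ae_equal_def UD by (simp only: Un_empty_left)
  next
    have "sqrt \<epsilon> \<le> cmod (g t)" if k: "k < K" "t \<in> E k" for k t
    proof -
      obtain s where s: "s \<in> B k" "t = real k / real K + s"
        using k(2) DB[of k] by (auto simp: E_def)
      have "t < real k / real K + 1 / real K" using s by (auto simp: B_def)
      also have "\<dots> = (real k + 1) / real K" by (simp add: add_divide_distrib)
      also have "\<dots> \<le> 1" using k(1) by simp
      finally have "frac t = t" using s by (intro frac_id) (auto simp: B_def)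
      then show ?thesis using s by (simp add: B_def periodic_ext_def add.commute)
    qed
    then show "AE t in lebesgue. t \<in> (\<Union>k<K. E k) \<longrightarrow> sqrt \<epsilon> \<le> cmod (g t)"
      by (intro always_eventually) auto
  qed
  then show ?thesis by blast
qed

text \<open>
  By periodicity it suffices to bound \<open>G\<close> on \<open>[0, 1/K]\<close>.  Apart from null sets a point \<open>t\<close> there has
  the form \<open>s - k/K\<close> with \<open>s\<close> in \<open>E\<^sub>k\<close>, and the \<open>k\<close>-th summand \<open>|g(s)|\<^sup>2\<close> is at least \<open>\<epsilon>\<^sup>2\<close>.
\<close>

lemma tiling_imp_periodization_bound:
  assumes K: "K > 0" and \<epsilon>: "\<epsilon> > 0" and E: "tiling_condition g \<epsilon> K E"
  shows "AE t in unit_leb. periodization g K t \<ge> \<epsilon>\<^sup>2 / real K"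
proof (rule AE_lebesgue_imp_unit, unfold AE_lebesgue_iff_negligible,
    rule negligible_periodic[of "1 / real K" "\<lambda>t. \<not> \<epsilon>\<^sup>2 / real K \<le> periodization g K t"])
  let ?U = "\<Union>k<K. (\<lambda>t. t - real k / real K) ` E k"
  define N where "N = {t. \<not> (t \<in> (\<Union>k<K. E k) \<longrightarrow> \<epsilon> \<le> cmod (g t))}"
  \<comment> \<open>a null set containing the exceptional points of \<open>[0, 1/K]\<close>: the right end point, where
      \<open>t + k/K\<close> may reach \<open>1\<close>, the defect of the covering, and the shifts by \<open>-k/K\<close> of the
      points of the \<open>E\<^sub>k\<close> at which \<open>|g| < \<epsilon>\<close>\<close>
  define Z where "Z = insert (1 / real K) ((?U - {0..1 / real K}) \<union> ({0..1 / real K} - ?U)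
      \<union> (\<Union>k<K. (+) (- (real k / real K)) ` N))"
  have "negligible N"
    using E unfolding tiling_condition_def N_def AE_lebesgue_iff_negligible by blast
  moreover have "negligible ((?U - {0..1 / real K}) \<union> ({0..1 / real K} - ?U))"
    using E unfolding tiling_condition_def ae_equal_def by blast
  ultimately have "negligible Z"
    unfolding Z_def negligible_insert
    by (intro negligible_Un negligible_Union finite_imageI) (auto simp del: uminus_add_conv_diff intro!: negligible_translation)
  moreover have "{t\<in>{0..1 / real K}. \<not> \<epsilon>\<^sup>2 / real K \<le> periodization g K t} \<subseteq> Z"
  proof (rule ccontr)
    assume "\<not> ?thesis"
    then obtain t where t: "0 \<le> t" "t \<le> 1 / real K" "\<not> \<epsilon>\<^sup>2 / real K \<le> periodization g K t" "t \<notin> Z"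
      by auto
    then have "t < 1 / real K" "t \<in> ?U"
      by (auto simp: Z_def)
    then obtain k s where k: "k < K" "s \<in> E k" "t = s - real k / real K"
      by auto
    have s: "s = t + real k / real K" using k by simp
    have "s \<notin> N"
      using t(4) k(1,3) by (force simp: Z_def)
    then have gs: "\<epsilon> \<le> cmod (g s)"
      using k by (auto simp: N_def)
    have "s < (real k + 1) / real K"
      using \<open>t < 1 / real K\<close> s by (simp add: add_divide_distrib)
    also have "\<dots> \<le> 1" using k(1) by simp
    finally have "periodic_ext g (t + real k / real K) = g s"
      using t(1) s by (simp add: periodic_ext_def frac_id)
    then have "\<epsilon>\<^sup>2 \<le> (cmod (periodic_ext g (t + real k / real K)))\<^sup>2"
      using gs \<epsilon> by (simp add: power_mono)
    also have "\<dots> \<le> (\<Sum>k<K. (cmod (periodic_ext g (t + real k / real K)))\<^sup>2)"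
      by (rule member_le_sum) (use k(1) in auto)
    finally have "\<epsilon>\<^sup>2 / real K \<le> periodization g K t"
      using K by (simp add: periodization_plus divide_right_mono)
    then show False using t(3) by simp
  qed
  ultimately show "negligible {t\<in>{0..1 / real K}. \<not> \<epsilon>\<^sup>2 / real K \<le> periodization g K t}"
    by (rule negligible_subset)
qed (use K in \<open>simp_all add: periodization_periodic\<close>)

theorem theorem6p17:
  fixes g :: "real \<Rightarrow> complex"
  assumes "g \<in> Linf_unit"
  defines "cond1 \<equiv> uniform_feichtinger (toeplitz_op g)"
  defines "cond2 \<equiv> \<exists>(K::nat) (\<epsilon>::real). K > 0 \<and> \<epsilon> > 0 \<and>
    (AE t in unit_leb.
       (1 / real K) * (\<Sum>k<K. (cmod (periodic_ext g (t - real k / real K)))\<^sup>2) \<ge> \<epsilon>)"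
  defines "cond3 \<equiv> \<exists>(\<epsilon>::real) (K::nat) (E :: nat \<Rightarrow> real set). \<epsilon> > 0 \<and> K > 0 \<and>
    (\<forall>k<K. E k \<in> sets lebesgue \<and> E k \<subseteq> {real k / real K .. (real k + 1) / real K}) \<and>
    pairwise (\<lambda>j k. ae_disjoint ((\<lambda>t. t - real j / real K) ` E j)
                                ((\<lambda>t. t - real k / real K) ` E k)) {..<K} \<and>
    ae_equal (\<Union>k<K. (\<lambda>t. t - real k / real K) ` E k) {0 .. 1 / real K} \<and>
    (AE t in lebesgue. t \<in> (\<Union>k<K. E k) \<longrightarrow> cmod (g t) \<ge> \<epsilon>)"
  shows "(cond1 \<longleftrightarrow> cond2) \<and> (cond2 \<longleftrightarrow> cond3)"
proof -
  have cond2: "cond2 \<longleftrightarrow> (\<exists>K \<epsilon>. K > 0 \<and> \<epsilon> > 0 \<and> (AE t in unit_leb. periodization g K t \<ge> \<epsilon>))"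
    unfolding cond2_def periodization_def by (rule refl)
  have cond3: "cond3 \<longleftrightarrow> (\<exists>\<epsilon> K E. \<epsilon> > 0 \<and> K > 0 \<and> tiling_condition g \<epsilon> K E)"
    unfolding cond3_def tiling_condition_def by (rule refl)
  have "cond1 \<longleftrightarrow> cond2"
  proof
    assume "cond1"
    then show "cond2"
      unfolding cond1_def cond2 by (rule uniform_feichtinger_imp_periodization_bound[OF assms(1)])
  next
    assume "cond2"
    then obtain K \<epsilon> where "K > 0" "\<epsilon> > 0" "AE t in unit_leb. periodization g K t \<ge> \<epsilon>"
      unfolding cond2 by (elim exE conjE)
    then show "cond1"
      unfolding cond1_def by (rule periodization_bound_imp_uniform_feichtinger[OF assms(1)])
  qed
  moreover have "cond2 \<longleftrightarrow> cond3"
  proof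
    assume "cond2"
    then obtain K \<epsilon> where K: "K > 0" "\<epsilon> > 0" "AE t in unit_leb. periodization g K t \<ge> \<epsilon>"
      unfolding cond2 by (elim exE conjE)
    obtain E where "tiling_condition g (sqrt \<epsilon>) K E"
      using periodization_bound_imp_tiling[OF assms(1) K] by (elim exE)
    moreover have "0 < sqrt \<epsilon>" using K(2) by simp
    ultimately show "cond3"
      unfolding cond3 using K(1) by (intro exI conjI)
  next
    assume "cond3"
    then obtain \<epsilon> K E where K: "\<epsilon> > 0" "K > 0" "tiling_condition g \<epsilon> K E"
      unfolding cond3 by (elim exE conjE)
    have "0 < \<epsilon>\<^sup>2 / real K" using K by simp
    then show "cond2"
      unfolding cond2 using tiling_imp_periodization_bound[OF K(2,1,3)] K(2) by (intro exI conjI)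
  qed
  ultimately show ?thesis by (rule conjI)
qed

end
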